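(* There exists a real Banach space $X$ which has the Daugavet property but does not have the weak operator Daugavet property (WODP).
   Context: For a normed space $X$, $B_X$ and $S_X$ denote its closed unit ball and unit sphere, $X^*$ its dual; operators are bounded linear maps. Scalars are real. Daugavet property: a normed space $X$ has the Daugavet property if $\|\mathrm{Id}+T\| = 1+\|T\|$ for every rank-one bounded linear operator $T\colon X\to X$. Slice: a slice of $B_X$ is a set of the form $\{x\in B_X : x^*(x) > 1-\alpha\}$ with $x^*\in S_{X^*}$ and $\alpha>0$. Weak operator Daugavet property (WODP): a Banach space $X$ has the WODP if, for all $n \in \mathbb{N}$ and $x_1,\dots,x_n\in S_X$, every $\varepsilon>0$, every slice $S$ of $B_X$, and every $x'\in B_X$, there exist $x\in S$ and an operator $T\colon X\to X$ such that (1) $\|T\|\le 1+\varepsilon$; (2) $\|T(x_i)-x_i\|<\varepsilon$ for every $i\in\{1,\dots,n\}$; (3) $\|T(x)-x'\|<\varepsilon$. *)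

theory Defs
  imports "HOL-Analysis.Abstract_Metric_Spaces" "HOL-Algebra.Module"
begin

text \<open>
  Banach spaces are treated as objects with an explicit carrier, since one of them has to be
  existentially quantified, which the type classes do not permit. A normed space is a module in
  the sense of HOL-Algebra, over the field of reals, together with a norm. As for all modules
  there, the fields \<open>mult\<close> and \<open>one\<close> inherited from the ring record carry no meaning.

  The carrier is an arbitrary subset of the type \<open>'a\<close>. Existence is to be asserted over a type
  such as \<open>real set\<close>, which is used only as a pool of points, large enough for every Banach
  space of cardinality at most that of the power set of the reals.
\<close>

record 'a normed_space = "(real, 'a) module" +
  vnorm :: "'a \<Rightarrow> real"

text \<open>
  The real line, used both as the ring of scalars and as the normed space that is the codomain
  of linear functionals.
\<close>

definition real_line :: "real normed_space" where
  "real_line = \<lparr>carrier = UNIV, mult = (*), one = 1, zero = 0, add = (+), smult = (*), vnorm = abs\<rparr>"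

locale real_normed_space = module real_line X for X :: "'a normed_space" (structure) +
  assumes vnorm_nonneg: "x \<in> carrier X \<Longrightarrow> 0 \<le> vnorm X x"
    and vnorm_eq_0_iff: "x \<in> carrier X \<Longrightarrow> vnorm X x = 0 \<longleftrightarrow> x = \<zero>\<^bsub>X\<^esub>"
    and vnorm_smult: "x \<in> carrier X \<Longrightarrow> vnorm X (a \<odot>\<^bsub>X\<^esub> x) = \<bar>a\<bar> * vnorm X x"
    and vnorm_triangle:
      "x \<in> carrier X \<Longrightarrow> y \<in> carrier X \<Longrightarrow> vnorm X (x \<oplus>\<^bsub>X\<^esub> y) \<le> vnorm X x + vnorm X y"

locale real_banach_space = real_normed_space X for X :: "'a normed_space" (structure) +
  assumes complete: "Metric_space.mcomplete (carrier X) (\<lambda>x y. vnorm X (x \<ominus>\<^bsub>X\<^esub> y))"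

definition unit_ball :: "'a normed_space \<Rightarrow> 'a set" where
  "unit_ball X = {x \<in> carrier X. vnorm X x \<le> 1}"

definition unit_sphere :: "'a normed_space \<Rightarrow> 'a set" where
  "unit_sphere X = {x \<in> carrier X. vnorm X x = 1}"

text \<open>Only the values of an operator on the carrier of its domain matter.\<close>

definition bounded_operator :: "'a normed_space \<Rightarrow> 'b normed_space \<Rightarrow> ('a \<Rightarrow> 'b) \<Rightarrow> bool" where
  "bounded_operator X Y T \<longleftrightarrow>
     (\<forall>x\<in>carrier X. T x \<in> carrier Y) \<and>
     (\<forall>x\<in>carrier X. \<forall>y\<in>carrier X. T (x \<oplus>\<^bsub>X\<^esub> y) = T x \<oplus>\<^bsub>Y\<^esub> T y) \<and>
     (\<forall>a. \<forall>x\<in>carrier X. T (a \<odot>\<^bsub>X\<^esub> x) = a \<odot>\<^bsub>Y\<^esub> T x) \<and>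
     (\<exists>K. \<forall>x\<in>carrier X. vnorm Y (T x) \<le> K * vnorm X x)"

definition operator_norm :: "'a normed_space \<Rightarrow> 'b normed_space \<Rightarrow> ('a \<Rightarrow> 'b) \<Rightarrow> real" where
  "operator_norm X Y T = (SUP x\<in>unit_ball X. vnorm Y (T x))"

text \<open>Rank one: the range is the linear span of a single nonzero vector.\<close>

definition rank_one :: "'a normed_space \<Rightarrow> 'b normed_space \<Rightarrow> ('a \<Rightarrow> 'b) \<Rightarrow> bool" where
  "rank_one X Y T \<longleftrightarrow>
     (\<exists>y\<in>carrier Y. y \<noteq> \<zero>\<^bsub>Y\<^esub> \<and> T ` carrier X = {a \<odot>\<^bsub>Y\<^esub> y | a. a \<in> UNIV})"

definition daugavet_property :: "'a normed_space \<Rightarrow> bool" where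
  "daugavet_property X \<longleftrightarrow>
     (\<forall>T. bounded_operator X X T \<and> rank_one X X T \<longrightarrow>
        operator_norm X X (\<lambda>x. x \<oplus>\<^bsub>X\<^esub> T x) = 1 + operator_norm X X T)"

definition is_slice :: "'a normed_space \<Rightarrow> 'a set \<Rightarrow> bool" where
  "is_slice X S \<longleftrightarrow>
     (\<exists>f \<alpha>. bounded_operator X real_line f \<and> operator_norm X real_line f = 1 \<and> \<alpha> > 0 \<and>
        S = {x \<in> unit_ball X. f x > 1 - \<alpha>})"

definition weak_operator_daugavet_property :: "'a normed_space \<Rightarrow> bool" where
  "weak_operator_daugavet_property X \<longleftrightarrow>
     (\<forall>(n::nat) (x :: nat \<Rightarrow> 'a) \<epsilon> S x'.
        (\<forall>i\<in>{1..n}. x i \<in> unit_sphere X) \<and> \<epsilon> > 0 \<and> is_slice X S \<and> x' \<in> unit_ball X \<longrightarrow>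
        (\<exists>u\<in>S. \<exists>T. bounded_operator X X T \<and>
           operator_norm X X T \<le> 1 + \<epsilon> \<and>
           (\<forall>i\<in>{1..n}. vnorm X (T (x i) \<ominus>\<^bsub>X\<^esub> x i) < \<epsilon>) \<and>
           vnorm X (T u \<ominus>\<^bsub>X\<^esub> x') < \<epsilon>))"

end

theory Submission
  imports Defs "HOL-Analysis.Bounded_Continuous_Function"
    "HOL-Analysis.Cartesian_Euclidean_Space"
begin

text \<open>
  Let \<open>C\<close> be the space of bounded continuous functions on the real line with the supremum norm. The
  counterexample is the sum \<open>C \<oplus> C\<close> with norm \<open>\<parallel>(y, z)\<parallel> = \<parallel>y\<parallel> + \<parallel>z\<parallel>\<close>.

  The Daugavet property asks, for each functional \<open>\<phi>\<close>, each \<open>p\<close> in the ball and each vector \<open>q\<close>, for a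
  \<open>p'\<close> in the ball with \<open>\<phi> p'\<close> not much below \<open>\<phi> p\<close> and \<open>\<parallel>p' + q\<parallel>\<close> almost \<open>1 + \<parallel>q\<parallel>\<close>. In \<open>C\<close> this holds
  because a function may be changed to the value \<open>\<plusminus>1\<close> at any one of many points near which \<open>\<bar>q\<bar>\<close> almost
  attains its supremum. These changes can be made to overlap so little that all their signed sums
  are bounded, hence \<open>\<phi>\<close> is small on one of them (\<open>slice_daugavet_bcontfun\<close>). The \<open>1\<close>-sum inherits the
  property, because a functional on it almost attains its norm on one of the summands
  (\<open>slice_daugavet_l1_norm\<close>).

  The WODP fails because operators of norm almost \<open>1\<close> that almost fix two suitable vectors cannot move
  a vector of the first summand noticeably into the second. Let \<open>w\<close> be of norm \<open>1\<close> in the first summand, and let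
  \<open>\<parallel>w \<plusminus> v\<parallel> \<le> 1\<close>. If \<open>T\<close> almost fixes \<open>(w, 0)\<close> and maps \<open>(v, 0)\<close> to \<open>(a, b)\<close>, then the norms of the images of
  \<open>(w \<plusminus> v, 0)\<close> are almost \<open>\<parallel>w \<plusminus> a\<parallel> + \<parallel>b\<parallel>\<close>. They add up to at most about \<open>2\<close>, while
  \<open>\<parallel>w + a\<parallel> + \<parallel>w - a\<parallel> \<ge> 2\<close>, so \<open>b\<close> is almost \<open>0\<close> (\<open>snd_image_small\<close>). In \<open>C\<close> any two functions in the unit
  ball with disjoint supports can serve as \<open>w\<close> and \<open>v\<close>, if \<open>w\<close> has norm \<open>1\<close>. Two fixed functions \<open>w\<close>,
  supported on different half-lines, therefore suffice to deal with all \<open>v\<close>, since each \<open>v\<close> splits into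
  two parts, one for each of them (\<open>flat_splitting_bcontfun\<close>). A slice given by a norm-one functional on the
  first summand, shallow enough that its members have small second components, and the target
  \<open>(0, 1)\<close> then contradict the WODP.

  Finally, a bounded continuous function is determined by the rational points below its graph, so
  pairs of such functions can be coded as sets of reals.
\<close>

section \<open>The sum norm on pairs\<close>

text \<open>Pairs are kept whole under quantifiers, so that the rules for the norm of a vector apply.\<close>

declare split_paired_All [simp del] split_paired_Ex [simp del]

definition l1_norm :: "'b::real_normed_vector \<times> 'c::real_normed_vector \<Rightarrow> real" where
  "l1_norm p = norm (fst p) + norm (snd p)"

lemma l1_norm_Pair [simp]: "l1_norm (y, z) = norm y + norm z"
  by (simp add: l1_norm_def)

lemma l1_norm_nonneg [simp]: "0 \<le> l1_norm p"
  by (simp add: l1_norm_def)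

lemma l1_norm_zero [simp]: "l1_norm 0 = 0"
  by (simp add: l1_norm_def)

lemma l1_norm_eq_0_iff [simp]: "l1_norm p = 0 \<longleftrightarrow> p = 0"
  by (simp add: l1_norm_def add_nonneg_eq_0_iff prod_eq_iff)

lemma l1_norm_scaleR [simp]: "l1_norm (a *\<^sub>R p) = \<bar>a\<bar> * l1_norm p"
  by (simp add: l1_norm_def algebra_simps)

lemma l1_norm_minus [simp]: "l1_norm (- p) = l1_norm p"
  by (simp add: l1_norm_def)

lemma l1_norm_triangle: "l1_norm (p + q) \<le> l1_norm p + l1_norm q"
  unfolding l1_norm_def using norm_triangle_ineq[of "fst p" "fst q"] norm_triangle_ineq[of "snd p" "snd q"]
  by simp

lemma norm_le_l1_norm: "norm p \<le> l1_norm p"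
  by (simp add: l1_norm_def norm_prod_def sqrt_sum_squares_le_sum)

lemma l1_norm_le_norm: "l1_norm p \<le> 2 * norm p"
  unfolding l1_norm_def using norm_fst_le[of "fst p" "snd p"] norm_snd_le[of "snd p" "fst p"] by simp

section \<open>The sum of two Banach spaces with points coded in another type\<close>

lemma cring_real_line: "cring real_line"
  by (intro cringI abelian_groupI comm_monoidI)
     (auto simp: real_line_def algebra_simps intro: exI[where x = "- _"])

lemma real_line_simps [simp]:
  "carrier real_line = UNIV" "x \<oplus>\<^bsub>real_line\<^esub> y = x + y" "x \<otimes>\<^bsub>real_line\<^esub> y = x * y"
  "a \<odot>\<^bsub>real_line\<^esub> x = a * x" "\<one>\<^bsub>real_line\<^esub> = 1" "\<zero>\<^bsub>real_line\<^esub> = 0" "vnorm real_line x = \<bar>x\<bar>"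
  by (simp_all add: real_line_def)

locale l1_sum =
  fixes j :: "'b::banach \<times> 'c::banach \<Rightarrow> 'a"
  assumes inj_j: "inj j"
begin

abbreviation decode :: "'a \<Rightarrow> 'b \<times> 'c" where
  "decode \<equiv> inv_into UNIV j"

text \<open>
  The ring multiplication is a dummy. Addition is given by its formula outside the carrier as well:
  then so is subtraction, and the distance is symmetric for all arguments, as the library's notion
  of a metric space demands (\<open>minus_X\<close>).
\<close>

definition X :: "'a normed_space" where
  "X = \<lparr>carrier = range j, monoid.mult = (\<lambda>a b. j 0), one = j 0, zero = j 0,
        add = (\<lambda>a b. j (decode a + decode b)), smult = (\<lambda>c a. j (c *\<^sub>R decode a)),
        vnorm = (\<lambda>a. l1_norm (decode a))\<rparr>"

lemma X_simps [simp]: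
  "carrier X = range j" "\<zero>\<^bsub>X\<^esub> = j 0" "j p \<oplus>\<^bsub>X\<^esub> j q = j (p + q)"
  "c \<odot>\<^bsub>X\<^esub> j p = j (c *\<^sub>R p)" "vnorm X (j p) = l1_norm p"
  by (simp_all add: X_def inj_j)

lemma carrier_X_E:
  assumes "x \<in> carrier X" obtains p where "x = j p"
  using assms by auto

lemma j_eq_iff [simp]: "j p = j q \<longleftrightarrow> p = q"
  using inj_j by (auto dest: injD)

lemma abelian_group_X: "abelian_group X"
proof (rule abelian_groupI)
  fix x assume "x \<in> carrier X"
  then obtain p where "x = j p" by auto
  then show "\<exists>y\<in>carrier X. y \<oplus>\<^bsub>X\<^esub> x = \<zero>\<^bsub>X\<^esub>"
    by (intro bexI[of _ "j (- p)"]) auto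
qed (auto simp: algebra_simps)

lemma minus_X: "x \<ominus>\<^bsub>X\<^esub> y = j (decode x - decode y)"
proof -
  have "\<ominus>\<^bsub>X\<^esub> y = j (- decode y)"
    unfolding a_inv_def m_inv_def
  proof (rule the_equality)
    show "j (- decode y) \<in> carrier (add_monoid X) \<and>
        y \<otimes>\<^bsub>add_monoid X\<^esub> j (- decode y) = \<one>\<^bsub>add_monoid X\<^esub> \<and>
        j (- decode y) \<otimes>\<^bsub>add_monoid X\<^esub> y = \<one>\<^bsub>add_monoid X\<^esub>"
      by (simp add: X_def inj_j)
  next
    fix z assume z: "z \<in> carrier (add_monoid X) \<and> y \<otimes>\<^bsub>add_monoid X\<^esub> z = \<one>\<^bsub>add_monoid X\<^esub> \<and>
        z \<otimes>\<^bsub>add_monoid X\<^esub> y = \<one>\<^bsub>add_monoid X\<^esub>"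
    then obtain p where "z = j p" by auto
    then show "z = j (- decode y)"
      using z by (simp add: X_def inj_j eq_neg_iff_add_eq_0)
  qed
  then show ?thesis by (simp add: a_minus_def X_def inj_j)
qed

lemma minus_X_j [simp]: "j p \<ominus>\<^bsub>X\<^esub> j q = j (p - q)"
  by (simp add: minus_X inj_j)

lemma real_normed_space_X: "real_normed_space X"
proof (intro real_normed_space.intro real_normed_space_axioms.intro moduleI cring_real_line abelian_group_X)
qed (elim carrier_X_E, simp add: algebra_simps l1_norm_triangle)+

lemma real_banach_space_X: "real_banach_space X"
proof (intro real_banach_space.intro real_normed_space_X real_banach_space_axioms.intro)
  let ?d = "\<lambda>x y. vnorm X (x \<ominus>\<^bsub>X\<^esub> y)"
  have M: "Metric_space (carrier X) ?d"
  proof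
    show "0 \<le> ?d x y" for x y by (simp add: X_def)
    fix x y assume "x \<in> carrier X" "y \<in> carrier X"
    then obtain p q where [simp]: "x = j p" "y = j q" by auto
    show "(?d x y = 0) = (x = y)" by simp
    fix z assume "z \<in> carrier X"
    then obtain r where [simp]: "z = j r" by auto
    show "?d x z \<le> ?d x y + ?d y z" using l1_norm_triangle[of "p - q" "q - r"] by simp
  next
    show "?d x y = ?d y x" for x y
      using l1_norm_minus[of "decode x - decode y"] by (simp add: minus_X)
  qed
  interpret Metric_space "carrier X" ?d by (rule M)
  show mcomplete
    unfolding mcomplete_def
  proof (intro allI impI)
    fix s assume s: "MCauchy s"
    then have "\<forall>n. \<exists>p. s n = j p" unfolding MCauchy_def by (auto simp: image_subset_iff)
    then obtain p where p: "\<And>n. s n = j (p n)" by metis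
    have "Cauchy p"
    proof (rule CauchyI)
      fix e :: real assume "e > 0"
      then obtain N where N: "\<And>m n. N \<le> m \<Longrightarrow> N \<le> n \<Longrightarrow> l1_norm (p m - p n) < e"
        using s unfolding MCauchy_def by (force simp: p)
      then show "\<exists>N. \<forall>m\<ge>N. \<forall>n\<ge>N. norm (p m - p n) < e"
        using le_less_trans[OF norm_le_l1_norm] by blast
    qed
    then obtain l where l: "p \<longlonglongrightarrow> l"
      using Cauchy_convergent_iff convergent_def by blast
    have "\<exists>N. \<forall>n\<ge>N. l1_norm (p n - l) < e" if "e > 0" for e
    proof -
      have "e / 2 > 0" using that by simp
      then obtain N where "\<forall>n\<ge>N. norm (p n - l) < e / 2"
        using LIMSEQ_D[OF l] by blast
      then show ?thesis
        using l1_norm_le_norm[of "p _ - l"] by (intro exI[of _ N]) (smt (verit) field_sum_of_halves)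
    qed
    then show "\<exists>x. limitin mtopology s x sequentially"
      unfolding limit_metric_sequentially by (intro exI[of _ "j l"]) (auto simp: p)
  qed
qed

lemma operator_X_decode:
  assumes "bounded_operator X X T"
  obtains L where "bounded_linear L" "\<And>p. T (j p) = j (L p)"
proof
  let ?L = "\<lambda>p. decode (T (j p))"
  have dec: "T (j p) = j (?L p)" for p
    using assms by (simp add: bounded_operator_def f_inv_into_f)
  then show "\<And>p. T (j p) = j (?L p)" .
  obtain K where "\<forall>x\<in>carrier X. vnorm X (T x) \<le> K * vnorm X x"
    using assms unfolding bounded_operator_def by blast
  then have K: "vnorm X (T (j p)) \<le> K * l1_norm p" for p by simp
  show "bounded_linear ?L"
  proof (rule bounded_linear_intro)
    fix p q :: "'b \<times> 'c" and c :: real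
    have "T (j p \<oplus>\<^bsub>X\<^esub> j q) = T (j p) \<oplus>\<^bsub>X\<^esub> T (j q)"
      and "T (c \<odot>\<^bsub>X\<^esub> j p) = c \<odot>\<^bsub>X\<^esub> T (j p)"
      using assms by (auto simp: bounded_operator_def simp del: X_simps(3,4))
    then show "?L (p + q) = ?L p + ?L q" "?L (c *\<^sub>R p) = c *\<^sub>R ?L p"
      by (metis X_simps(3) dec j_eq_iff, metis X_simps(4) dec j_eq_iff)
    have "norm (?L p) \<le> l1_norm (?L p)" by (rule norm_le_l1_norm)
    also have "\<dots> \<le> K * l1_norm p" using K[of p] by (metis dec X_simps(5))
    also have "\<dots> \<le> \<bar>K\<bar> * (2 * norm p)"
      by (intro mult_mono l1_norm_le_norm) auto
    finally show "norm (?L p) \<le> norm p * (2 * \<bar>K\<bar>)" by (simp add: mult_ac)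
  qed
qed

lemma unit_ball_X: "unit_ball X = j ` {p. l1_norm p \<le> 1}"
  by (auto simp: unit_ball_def)

lemma operator_norm_X:
  assumes "\<And>p. T (j p) = j (L p)"
  shows "operator_norm X X T = (SUP p\<in>{p. l1_norm p \<le> 1}. l1_norm (L p))"
  unfolding operator_norm_def unit_ball_X image_image by (simp add: assms)

lemma bdd_above_l1_norm_image:
  assumes "bounded_linear L"
  shows "bdd_above ((\<lambda>p. l1_norm (L p)) ` {p. l1_norm p \<le> 1})"
proof -
  obtain K where K: "\<And>p. norm (L p) \<le> norm p * K" "K \<ge> 0"
    using bounded_linear.nonneg_bounded[OF assms] by blast
  have "l1_norm (L p) \<le> 2 * K" if "l1_norm p \<le> 1" for p
    using l1_norm_le_norm[of "L p"] K(1)[of p] mult_right_mono[of "norm p" 1 K] K(2)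
      norm_le_l1_norm[of p] that by simp
  then show ?thesis by (auto intro!: bdd_aboveI2)
qed

lemma l1_norm_le_operator_norm:
  assumes L: "bounded_linear L" "\<And>p. T (j p) = j (L p)"
  shows "l1_norm (L p) \<le> operator_norm X X T * l1_norm p"
proof (cases "p = 0")
  case True
  then show ?thesis using L(1) by (simp add: linear_simps)
next
  case False
  define c where "c = l1_norm p"
  have c: "c > 0" using False by (simp add: c_def less_le)
  have "l1_norm (L (p /\<^sub>R c)) \<le> operator_norm X X T"
    unfolding operator_norm_X[of T L, OF L(2)] using c
    by (intro cSUP_upper bdd_above_l1_norm_image L(1)) (simp flip: c_def)
  then show ?thesis
    using c L(1) by (simp add: linear_simps field_simps flip: c_def)
qed

end

section \<open>The Daugavet property\<close>

text \<open>
  This is the description of the Daugavet property by slices, for a single functional \<open>\<phi>\<close> and with \<open>q\<close>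
  of arbitrary norm instead of norm \<open>1\<close>.
\<close>

definition slice_daugavet :: "('b::real_vector \<Rightarrow> real) \<Rightarrow> ('b \<Rightarrow> real) \<Rightarrow> bool" where
  "slice_daugavet N \<phi> \<longleftrightarrow>
     (\<forall>p q \<delta>. N p \<le> 1 \<and> \<delta> > 0 \<longrightarrow> 
        (\<exists>p'. N p' \<le> 1 \<and> \<phi> p' > \<phi> p - \<delta> \<and> N (p' + q) > 1 + N q - \<delta>))"

lemma slice_daugavetD:
  assumes "slice_daugavet N \<phi>" "N p \<le> 1" "\<delta> > 0"
  obtains p' where "N p' \<le> 1" "\<phi> p' > \<phi> p - \<delta>" "N (p' + q) > 1 + N q - \<delta>"
  using assms unfolding slice_daugavet_def by blast

text \<open>
  Since \<open>\<parallel>y\<parallel> + \<parallel>z\<parallel> \<le> 1\<close>, the value \<open>\<phi> (y, z)\<close> is reached or exceeded at a point of the unit ball of one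
  of the summands. The point \<open>p'\<close> can be sought in that summand alone, because the other component
  of \<open>q\<close> then keeps its full contribution to the norm.
\<close>

lemma slice_daugavet_l1_norm:
  fixes \<phi> :: "'b::real_normed_vector \<times> 'c::real_normed_vector \<Rightarrow> real"
  assumes \<phi>: "linear \<phi>"
    and 1: "slice_daugavet norm (\<lambda>y. \<phi> (y, 0))"
    and 2: "slice_daugavet norm (\<lambda>z. \<phi> (0, z))"
  shows "slice_daugavet l1_norm \<phi>"
  unfolding slice_daugavet_def
proof (intro allI impI)
  fix p q :: "'b \<times> 'c" and \<delta> :: real
  assume asm: "l1_norm p \<le> 1 \<and> \<delta> > 0"
  obtain f g h k where [simp]: "p = (f, g)" "q = (h, k)" by fastforce
  have add: "\<phi> p = \<phi> (f, 0) + \<phi> (0, g)"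
    using linear_add[OF \<phi>, of "(f, 0)" "(0, g)"] by simp
  have zero: "\<phi> (0, 0) = 0" using linear_0[OF \<phi>] by (simp add: zero_prod_def)
  consider y where "norm y \<le> 1" "\<phi> (y, 0) \<ge> \<phi> p" | z where "norm z \<le> 1" "\<phi> (0, z) \<ge> \<phi> p"
  proof -
    have False if y: "\<forall>y. norm y \<le> 1 \<longrightarrow> \<phi> (y, 0) < \<phi> p" and z: "\<forall>z. norm z \<le> 1 \<longrightarrow> \<phi> (0, z) < \<phi> p"
    proof -
      have pos: "0 < \<phi> p" using y[rule_format, of 0] zero by simp
      have yy: "\<phi> (y, 0) < norm y * \<phi> p" if "y \<noteq> 0" for y
      proof -
        have "\<phi> (y /\<^sub>R norm y, 0) = \<phi> (y, 0) / norm y"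
          using linear_cmul[OF \<phi>, of "inverse (norm y)" "(y, 0)"] by (simp add: divide_inverse_commute)
        moreover have "\<phi> (y /\<^sub>R norm y, 0) < \<phi> p" using y that by simp
        ultimately show ?thesis using that by (simp add: pos_divide_less_eq mult.commute)
      qed
      have zz: "\<phi> (0, z) < norm z * \<phi> p" if "z \<noteq> 0" for z
      proof -
        have "\<phi> (0, z /\<^sub>R norm z) = \<phi> (0, z) / norm z"
          using linear_cmul[OF \<phi>, of "inverse (norm z)" "(0, z)"] by (simp add: divide_inverse_commute)
        moreover have "\<phi> (0, z /\<^sub>R norm z) < \<phi> p" using z that by simp
        ultimately show ?thesis using that by (simp add: pos_divide_less_eq mult.commute)
      qed
      have "\<phi> p < norm f * \<phi> p + norm g * \<phi> p"
      proof (cases "f = 0")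
        case True
        then show ?thesis using zz[of g] add zero pos by (cases "g = 0") auto
      next
        case False
        then show ?thesis using yy[of f] zz[of g] add zero by (cases "g = 0") auto
      qed
      also have "\<dots> = l1_norm p * \<phi> p" by (simp add: algebra_simps)
      also have "\<dots> \<le> \<phi> p" using asm pos mult_right_mono[of "l1_norm p" 1 "\<phi> p"] by simp
      finally show False by simp
    qed
    then show ?thesis using that by (meson not_le)
  qed
  then show "\<exists>p'. l1_norm p' \<le> 1 \<and> \<phi> p' > \<phi> p - \<delta> \<and> l1_norm (p' + q) > 1 + l1_norm q - \<delta>"
  proof cases
    case 1
    obtain y' where "norm y' \<le> 1" "\<phi> (y', 0) > \<phi> (y, 0) - \<delta>" "norm (y' + h) > 1 + norm h - \<delta>"
      using slice_daugavetD[OF assms(2) 1(1)] asm by blast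
    then show ?thesis using 1 by (intro exI[of _ "(y', 0)"]) auto
  next
    case 2
    obtain z' where "norm z' \<le> 1" "\<phi> (0, z') > \<phi> (0, z) - \<delta>" "norm (z' + k) > 1 + norm k - \<delta>"
      using slice_daugavetD[OF assms(3) 2(1)] asm by blast
    then show ?thesis using 2 by (intro exI[of _ "(0, z')"]) auto
  qed
qed

lemma rank_one_functional:
  fixes L :: "'b::real_normed_vector \<Rightarrow> 'b"
  assumes L: "bounded_linear L" and y: "y \<noteq> 0" and "range L \<subseteq> range (\<lambda>a. a *\<^sub>R y)"
  obtains \<phi> where "bounded_linear \<phi>" "\<And>p. L p = \<phi> p *\<^sub>R y"
proof -
  have "\<forall>p. \<exists>a. L p = a *\<^sub>R y" using assms(3) by auto
  then obtain \<phi> where \<phi>: "\<And>p. L p = \<phi> p *\<^sub>R y" by metis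
  obtain K where K: "\<And>p. norm (L p) \<le> norm p * K"
    using bounded_linear.nonneg_bounded[OF L] by blast
  have "bounded_linear \<phi>"
  proof (rule bounded_linear_intro)
    fix p q :: 'b and r :: real
    have "\<phi> (p + q) *\<^sub>R y = (\<phi> p + \<phi> q) *\<^sub>R y"
      unfolding scaleR_add_left \<phi>[symmetric] using L by (rule bounded_linear.linear[THEN linear_add])
    then show "\<phi> (p + q) = \<phi> p + \<phi> q" using y by simp
    have "\<phi> (r *\<^sub>R p) *\<^sub>R y = (r *\<^sub>R \<phi> p) *\<^sub>R y"
      unfolding real_scaleR_def scaleR_scaleR[symmetric] \<phi>[symmetric]
      using L by (rule bounded_linear.linear[THEN linear_cmul])
    then show "\<phi> (r *\<^sub>R p) = r *\<^sub>R \<phi> p" using y by simp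
    show "norm (\<phi> p) \<le> norm p * (K / norm y)"
      using K[of p] y by (simp add: \<phi> field_simps)
  qed
  then show thesis using \<phi> that by blast
qed

context l1_sum
begin

text \<open>
  Writing \<open>L p = \<phi> p \<cdot> y\<close>, the slice property is applied to \<open>q = L p\<close> for a \<open>p\<close> at which \<open>L\<close> almost attains
  its norm.
\<close>

lemma daugavet_property_X:
  assumes Y: "\<And>\<phi> :: 'b \<Rightarrow> real. bounded_linear \<phi> \<Longrightarrow> slice_daugavet norm \<phi>"
    and Z: "\<And>\<phi> :: 'c \<Rightarrow> real. bounded_linear \<phi> \<Longrightarrow> slice_daugavet norm \<phi>"
  shows "daugavet_property X"
  unfolding daugavet_property_def
proof (intro allI impI, elim conjE)
  fix T assume T: "bounded_operator X X T" and "rank_one X X T"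
  obtain L where L: "bounded_linear L" "\<And>p. T (j p) = j (L p)"
    using operator_X_decode[OF T] by metis
  obtain y where y: "y \<noteq> 0" "range (\<lambda>p. j (L p)) = range (\<lambda>a. j (a *\<^sub>R y))"
    using \<open>rank_one X X T\<close> by (auto simp: rank_one_def image_image L full_SetCompr_eq)
  have "range L \<subseteq> range (\<lambda>a. a *\<^sub>R y)" using y(2) by (force simp: image_iff set_eq_iff)
  then obtain \<phi> where \<phi>: "bounded_linear \<phi>" "\<And>p. L p = \<phi> p *\<^sub>R y"
    using rank_one_functional[OF L(1) y(1)] by metis
  have "bounded_linear (\<lambda>y. \<phi> (y, 0))" "bounded_linear (\<lambda>z. \<phi> (0, z))"
    by (intro bounded_linear_compose[OF \<phi>(1)] bounded_linear_Pair bounded_linear_ident bounded_linear_zero)+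
  then have sd: "slice_daugavet l1_norm \<phi>"
    using slice_daugavet_l1_norm Y Z bounded_linear.linear[OF \<phi>(1)] by blast
  define c where "c = l1_norm y"
  have c: "c > 0" using y(1) by (simp add: c_def less_le)
  define M where "M = operator_norm X X T"
  have M_upper: "\<bar>\<phi> p\<bar> * c \<le> M" if "l1_norm p \<le> 1" for p
    using cSUP_upper[OF _ bdd_above_l1_norm_image[OF L(1)], of p] that
    unfolding M_def operator_norm_X[of T L, OF L(2)] by (simp add: \<phi>(2) c_def)
  let ?S = "SUP p\<in>{p. l1_norm p \<le> 1}. l1_norm (p + L p)"
  have S: "operator_norm X X (\<lambda>x. x \<oplus>\<^bsub>X\<^esub> T x) = ?S"
    by (rule operator_norm_X) (simp add: L)
  have bdd: "bdd_above ((\<lambda>p. l1_norm (p + L p)) ` {p. l1_norm p \<le> 1})"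
    by (intro bdd_above_l1_norm_image bounded_linear_add bounded_linear_ident L(1))
  have ne: "{p :: 'b \<times> 'c. l1_norm p \<le> 1} \<noteq> {}" by (auto intro: exI[of _ 0])
  have "?S \<le> 1 + M"
  proof (rule cSUP_least[OF ne])
    fix p :: "'b \<times> 'c" assume "p \<in> {p. l1_norm p \<le> 1}"
    then show "l1_norm (p + L p) \<le> 1 + M"
      using l1_norm_triangle[of p "L p"] M_upper[of p] by (simp add: \<phi>(2) c_def)
  qed
  moreover have "1 + M \<le> ?S"
  proof (rule field_le_epsilon)
    fix e :: real assume "e > 0"
    have "\<exists>p. l1_norm p \<le> 1 \<and> M - e / 4 < l1_norm (L p)"
      using less_cSUP_iff[OF ne bdd_above_l1_norm_image[OF L(1)], of "M - e / 4"] \<open>e > 0\<close>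
      unfolding M_def operator_norm_X[of T L, OF L(2)] by auto
    then obtain p0 where p0: "l1_norm p0 \<le> 1" "M - e / 4 < \<bar>\<phi> p0\<bar> * c"
      by (auto simp: \<phi>(2) c_def)
    obtain p where p: "l1_norm p \<le> 1" "M - e / 4 < \<phi> p * c" "\<phi> p \<ge> 0"
    proof (cases "\<phi> p0 \<ge> 0")
      case True
      then show thesis using p0 that[of p0] by simp
    next
      case False
      then show thesis using p0 that[of "- p0"] \<phi>(1) by (simp add: linear_simps)
    qed
    define \<delta> where "\<delta> = min (e / 4) (e / (4 * c))"
    have \<delta>: "\<delta> > 0" "\<delta> \<le> e / 4" "\<delta> * c \<le> e / 4"
      using \<open>e > 0\<close> c by (auto simp: \<delta>_def min_def field_simps)
    obtain p' where p': "l1_norm p' \<le> 1" "\<phi> p' > \<phi> p - \<delta>"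
      "l1_norm (p' + \<phi> p *\<^sub>R y) > 1 + l1_norm (\<phi> p *\<^sub>R y) - \<delta>"
      using slice_daugavetD[OF sd p(1) \<delta>(1)] by blast
    \<comment> \<open>The slice bounds \<open>\<phi> p'\<close> from below; from above, \<open>p\<close> is already almost optimal.\<close>
    have "\<bar>\<phi> p - \<phi> p'\<bar> * c \<le> e / 4"
    proof (cases "\<phi> p \<ge> \<phi> p'")
      case True
      then have "\<bar>\<phi> p - \<phi> p'\<bar> * c \<le> \<delta> * c" using p'(2) c by (intro mult_right_mono) auto
      then show ?thesis using \<delta> by simp
    next
      case False
      then show ?thesis using p(2) M_upper[OF p'(1)] p(3) by (simp add: algebra_simps)
    qed
    moreover have "l1_norm (p' + \<phi> p *\<^sub>R y) \<le> l1_norm (p' + L p') + \<bar>\<phi> p - \<phi> p'\<bar> * c"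
    proof -
      have "p' + \<phi> p *\<^sub>R y = p' + L p' + (\<phi> p - \<phi> p') *\<^sub>R y"
        by (simp add: \<phi>(2) algebra_simps)
      then show ?thesis
        using l1_norm_triangle[of "p' + L p'" "(\<phi> p - \<phi> p') *\<^sub>R y"] by (simp only: l1_norm_scaleR c_def)
    qed
    moreover have "l1_norm (p' + L p') \<le> ?S"
      using p'(1) by (intro cSUP_upper bdd) simp
    ultimately show "1 + M \<le> ?S + e"
      using p'(3) p \<delta> c \<open>e > 0\<close> by (simp add: c_def[symmetric])
  qed
  ultimately show "operator_norm X X (\<lambda>x. x \<oplus>\<^bsub>X\<^esub> T x) = 1 + operator_norm X X T"
    unfolding S M_def by simp
qed

end

section \<open>Failure of the weak operator Daugavet property\<close>

text \<open>
  The property of the first summand that defeats the WODP. Both vectors \<open>w1\<close> and \<open>w2\<close> are far from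
  extreme: the unit ball contains a segment centred at \<open>w1\<close> in the direction \<open>v1\<close>, and one centred at
  \<open>w2\<close> in the direction \<open>v2\<close>, and such directions add up to every vector of the unit ball.
  An \<open>\<infinity>\<close>-sum of two nonzero spaces is the typical example, with \<open>w1\<close> and \<open>w2\<close> in different summands.
\<close>

definition flat_splitting :: "'b::real_normed_vector \<Rightarrow> 'b \<Rightarrow> bool" where
  "flat_splitting w1 w2 \<longleftrightarrow> norm w1 = 1 \<and> norm w2 = 1 \<and>
     (\<forall>y. norm y \<le> 1 \<longrightarrow> (\<exists>v1 v2. y = v1 + v2 \<and> norm (w1 + v1) \<le> 1 \<and> norm (w1 - v1) \<le> 1 \<and>
        norm (w2 + v2) \<le> 1 \<and> norm (w2 - v2) \<le> 1))"

context l1_sum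
begin

text \<open>
  Here the \<open>1\<close>-sum does its work. Both \<open>w + v\<close> and \<open>w - v\<close> have norm at most \<open>1\<close>. Their images have
  first components whose mean is almost \<open>w\<close>, so the norms of these components add up to at least
  almost \<open>2\<close>. The norm of an image is at most \<open>1 + \<epsilon>\<close> and is the sum of the norms of its components, so next to nothing is
  left for the second components.
\<close>

lemma snd_image_small:
  assumes L: "bounded_linear L" and L_le: "\<And>p. l1_norm (L p) \<le> (1 + \<epsilon>) * l1_norm p"
    and fix_w: "l1_norm (L (w, 0) - (w, 0)) < \<epsilon>" and "\<epsilon> > 0"
    and w: "norm w = 1" and "norm (w + v) \<le> 1" "norm (w - v) \<le> 1"
  shows "norm (snd (L (v, 0))) \<le> 2 * \<epsilon>"
proof -
  obtain a b where ab: "L (v, 0) = (a, b)" by fastforce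
  obtain c d where cd: "L (w, 0) = (c, d)" by fastforce
  have "L ((w, 0) + (v, 0)) = (c + a, d + b)" "L ((w, 0) - (v, 0)) = (c - a, d - b)"
    using L ab cd by (simp_all only: linear_simps) simp_all
  moreover have "l1_norm (L (x, 0)) \<le> 1 + \<epsilon>" if "norm x \<le> 1" for x
  proof -
    have "l1_norm (L (x, 0)) \<le> (1 + \<epsilon>) * norm x" using L_le[of "(x, 0)"] by simp
    also have "\<dots> \<le> (1 + \<epsilon>) * 1" using that \<open>\<epsilon> > 0\<close> by (intro mult_left_mono) auto
    finally show ?thesis by simp
  qed
  ultimately have 1: "norm (c + a) + norm (d + b) \<le> 1 + \<epsilon>" "norm (c - a) + norm (d - b) \<le> 1 + \<epsilon>"
    using assms(6,7) by fastforce+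
  have "2 * norm c \<le> norm (c + a) + norm (c - a)"
    using norm_triangle_ineq[of "c + a" "c - a"] by (simp flip: scaleR_2)
  moreover have "2 * norm b \<le> norm (d + b) + norm (d - b)"
    using norm_triangle_ineq4[of "d + b" "d - b"] by (simp flip: scaleR_2)
  moreover have "norm (c - w) < \<epsilon>" 
    using fix_w by (simp add: cd) (smt (verit) norm_ge_zero)
  moreover have "1 \<le> norm c + norm (c - w)"
    using norm_triangle_sub[of w c] w by (simp add: norm_minus_commute)
  ultimately show ?thesis using 1 by (simp add: ab)
qed

text \<open>
  Applied with \<open>\<epsilon> = 1/8\<close> to the points \<open>(w1, 0)\<close> and \<open>(w2, 0)\<close>, the target \<open>(0, z0)\<close> and the slice
  \<open>\<psi> y > 3/4\<close>, the WODP gives a point \<open>(y, z)\<close> with \<open>\<parallel>z\<parallel> < 1/4\<close>. The second component of its image has norm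
  at most \<open>1/4 + 1/4\<close> from the two parts of \<open>y\<close>, and less than \<open>9/8 \<cdot> 1/4\<close> from \<open>z\<close>. Together this is less
  than \<open>7/8\<close>, whereas \<open>z0\<close> is approximated to within \<open>1/8\<close>.
\<close>

lemma not_weak_operator_daugavet_property_X:
  fixes w1 w2 y0 :: 'b and z0 :: 'c and \<psi> :: "'b \<Rightarrow> real"
  assumes flat: "flat_splitting w1 w2" and z0: "norm z0 = 1"
    and \<psi>: "linear \<psi>" "\<And>y. \<bar>\<psi> y\<bar> \<le> norm y" and y0: "norm y0 = 1" "\<psi> y0 = 1"
  shows "\<not> weak_operator_daugavet_property X"
proof
  assume wodp: "weak_operator_daugavet_property X"
  have w: "norm w1 = 1" "norm w2 = 1" using flat by (simp_all add: flat_splitting_def)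
  define S where "S = {x \<in> unit_ball X. \<psi> (fst (decode x)) > 1 - 1 / 4}"
  have "is_slice X S"
    unfolding is_slice_def
  proof (intro exI conjI)
    let ?f = "\<lambda>x. \<psi> (fst (decode x))"
    have le: "\<bar>\<psi> (fst p)\<bar> \<le> l1_norm p" for p :: "'b \<times> 'c"
      using \<psi>(2)[of "fst p"] by (simp add: l1_norm_def add_increasing2)
    show "bounded_operator X real_line ?f"
      using le by (auto simp: bounded_operator_def inj_j linear_add[OF \<psi>(1)] linear_cmul[OF \<psi>(1)]
          intro!: exI[of _ 1])
    have "operator_norm X real_line ?f = (SUP p\<in>{p :: 'b \<times> 'c. l1_norm p \<le> 1}. \<bar>\<psi> (fst p)\<bar>)"
      unfolding operator_norm_def unit_ball_X image_image by (simp add: inj_j)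
    also have "\<dots> = 1"
    proof (rule cSup_eq_maximum)
      show "1 \<in> (\<lambda>p. \<bar>\<psi> (fst p)\<bar>) ` {p :: 'b \<times> 'c. l1_norm p \<le> 1}"
        using y0 by (intro image_eqI[of _ _ "(y0, 0)"]) auto
    qed (use le order_trans in blast)
    finally show "operator_norm X real_line ?f = 1" .
    show "(1 / 4 :: real) > 0" by simp
  qed (rule S_def)
  moreover have "\<forall>i\<in>{1..2::nat}. (if i = 1 then j (w1, 0) else j (w2, 0)) \<in> unit_sphere X"
    using w by (auto simp: unit_sphere_def)
  moreover have "j (0, z0) \<in> unit_ball X" using z0 by (simp add: unit_ball_def)
  ultimately have "\<exists>u\<in>S. \<exists>T. bounded_operator X X T \<and> operator_norm X X T \<le> 1 + 1 / 8 \<and>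
      (\<forall>i\<in>{1..2::nat}. vnorm X (T (if i = 1 then j (w1, 0) else j (w2, 0)) \<ominus>\<^bsub>X\<^esub>
          (if i = 1 then j (w1, 0) else j (w2, 0))) < 1 / 8) \<and>
      vnorm X (T u \<ominus>\<^bsub>X\<^esub> j (0, z0)) < 1 / 8"
    by (intro wodp[unfolded weak_operator_daugavet_property_def, rule_format]) (auto split: if_splits)
  then obtain u T where u: "u \<in> S" and T: "bounded_operator X X T" "operator_norm X X T \<le> 1 + 1 / 8"
    and Tw: "\<And>i. i \<in> {1..2::nat} \<Longrightarrow> vnorm X (T (if i = 1 then j (w1, 0) else j (w2, 0)) \<ominus>\<^bsub>X\<^esub>
          (if i = 1 then j (w1, 0) else j (w2, 0))) < 1 / 8"
    and Tu: "vnorm X (T u \<ominus>\<^bsub>X\<^esub> j (0, z0)) < 1 / 8" by blast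
  obtain L where L: "bounded_linear L" "\<And>p. T (j p) = j (L p)"
    using operator_X_decode[OF T(1)] by metis
  have L_le: "l1_norm (L p) \<le> (1 + 1 / 8) * l1_norm p" for p
    using l1_norm_le_operator_norm[of L T p, OF L] mult_right_mono[OF T(2) l1_norm_nonneg[of p]] by simp
  have Lw: "l1_norm (L (w1, 0) - (w1, 0)) < 1 / 8" "l1_norm (L (w2, 0) - (w2, 0)) < 1 / 8"
    using Tw[of 1] Tw[of 2] by (simp_all add: L)
  obtain y z where yz: "u = j (y, z)" "norm y + norm z \<le> 1" "\<psi> y > 3 / 4"
    using u by (auto simp: S_def unit_ball_X inj_j)
  have "norm y > 3 / 4" using \<psi>(2)[of y] yz(3) by simp
  then have z: "norm z < 1 / 4" "norm y \<le> 1" using yz(2) norm_ge_zero[of z] by linarith+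
  obtain v1 v2 where v: "y = v1 + v2" "norm (w1 + v1) \<le> 1" "norm (w1 - v1) \<le> 1"
    "norm (w2 + v2) \<le> 1" "norm (w2 - v2) \<le> 1"
    using flat z(2) unfolding flat_splitting_def by blast
  have small: "norm (snd (L (v1, 0))) \<le> 2 * (1 / 8)" "norm (snd (L (v2, 0))) \<le> 2 * (1 / 8)"
    by (rule snd_image_small[OF L(1) L_le]; use Lw w v in simp)+
  have "(y, z) = (v1, 0) + (v2, 0) + (0, z)" using v(1) by simp
  then have "L (y, z) = L (v1, 0) + L (v2, 0) + L (0, z)"
    using L(1) by (simp only: linear_simps)
  then have "norm (snd (L (y, z))) \<le> norm (snd (L (v1, 0))) + norm (snd (L (v2, 0))) + norm (snd (L (0, z)))"
    by (simp add: norm_triangle_le norm_triangle_ineq)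
  moreover have "norm (snd (L (0, z))) \<le> 9 / 8 * norm z"
    using L_le[of "(0, z)"] by (simp add: l1_norm_def) (smt (verit) norm_ge_zero)
  moreover have "norm (snd (L (y, z)) - z0) < 1 / 8"
    using Tu by (simp add: yz(1) L l1_norm_def) (smt (verit) norm_ge_zero)
  moreover have "1 \<le> norm (snd (L (y, z))) + norm (snd (L (y, z)) - z0)"
    using norm_triangle_sub[of z0 "snd (L (y, z))"] z0 by (simp add: norm_minus_commute)
  ultimately show False using small z by simp
qed

end

section \<open>Bounded continuous functions on the real line\<close>

instance bcontfun :: (metric_space, banach) banach ..

lemma bcontfun_of_function:
  fixes f :: "real \<Rightarrow> real"
  assumes "continuous_on UNIV f" "\<And>x. \<bar>f x\<bar> \<le> b"
  obtains g :: "real \<Rightarrow>\<^sub>C real" where "\<And>x. g x = f x"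
  using bcontfunE[OF bcontfun_normI[of f b]] assms by (metis real_norm_def)

definition ramp :: "real \<Rightarrow> real" where
  "ramp t = max 0 (min 1 t)"

lemma continuous_on_ramp [continuous_intros]:
  "continuous_on A f \<Longrightarrow> continuous_on A (\<lambda>x. ramp (f x))"
  unfolding ramp_def by (intro continuous_intros)

lemma ramp_bounds: "0 \<le> ramp t" "ramp t \<le> 1"
  by (auto simp: ramp_def)

lemma ramp_mono: "s \<le> t \<Longrightarrow> ramp s \<le> ramp t"
  by (auto simp: ramp_def)

text \<open>
  The tent of height \<open>1\<close> on \<open>[n - 1, n + 1]\<close>, written as a difference of ramps so that sums over \<open>n\<close>
  telescope.
\<close>

definition tent :: "nat \<Rightarrow> real \<Rightarrow> real" where
  "tent n x = ramp (x - real n + 1) - ramp (x - real n)"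

lemma tent_bounds: "0 \<le> tent n x" "tent n x \<le> 1"
  using ramp_mono[of "x - real n" "x - real n + 1"] ramp_bounds[of "x - real n + 1"] ramp_bounds[of "x - real n"]
  by (auto simp: tent_def)

lemma tent_peak: "tent n (real n) = 1"
  by (simp add: tent_def ramp_def)

lemma sum_tent_le_1: "(\<Sum>n<N. tent n x) \<le> 1"
proof -
  have "(\<Sum>n<N. tent n x) = ramp (x + 1) - ramp (x + 1 - real N)"
    by (induction N) (auto simp: tent_def algebra_simps)
  then show ?thesis using ramp_bounds[of "x + 1"] ramp_bounds[of "x + 1 - real N"] by simp
qed

text \<open>
  The candidates are \<open>f + d n\<close>, where \<open>d n\<close> moves \<open>f\<close> towards the constant \<open>\<sigma> = \<plusminus>1\<close> with weight a narrow
  tent. All peaks lie in an interval on which \<open>\<sigma> h\<close> is almost \<open>\<parallel>h\<parallel>\<close>, and at a peak the candidate equals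
  \<open>\<sigma>\<close>. As the tents add up to at most \<open>1\<close>, each sum \<open>\<Sum>\<plusminus>d n\<close> has norm at most \<open>2\<close>; choosing the signs
  of \<open>\<phi> (d n)\<close> bounds \<open>\<Sum>\<bar>\<phi> (d n)\<bar>\<close>, so with enough tents some \<open>\<phi> (d n)\<close> is small.
\<close>

lemma slice_daugavet_bcontfun:
  fixes \<phi> :: "(real \<Rightarrow>\<^sub>C real) \<Rightarrow> real"
  assumes \<phi>: "bounded_linear \<phi>"
  shows "slice_daugavet norm \<phi>"
  unfolding slice_daugavet_def
proof (intro allI impI, elim conjE)
  fix f h :: "real \<Rightarrow>\<^sub>C real" and \<delta> :: real
  assume f: "norm f \<le> 1" and "\<delta> > 0"
  have fx: "\<bar>f t\<bar> \<le> 1" for t using norm_bounded[of f t] f by simp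
  have "\<not> (\<forall>t. norm (h t) \<le> norm h - \<delta> / 2)"
    using norm_bound[of h "norm h - \<delta> / 2"] \<open>\<delta> > 0\<close> by auto
  then obtain t0 where t0: "\<bar>h t0\<bar> > norm h - \<delta> / 2" by (auto simp: not_le)
  define \<sigma> :: real where "\<sigma> = (if h t0 \<ge> 0 then 1 else - 1)"
  have "continuous_on UNIV (apply_bcontfun h)" by simp
  then obtain r where r: "r > 0" "\<And>t. \<bar>t - t0\<bar> < r \<Longrightarrow> \<bar>h t - h t0\<bar> < \<delta> / 2"
    unfolding continuous_on_iff dist_real_def
    by (metis UNIV_I \<open>\<delta> > 0\<close> half_gt_zero)
  have hit: "\<sigma> * h t > norm h - \<delta>" if "\<bar>t - t0\<bar> < r" for t
  proof (cases "h t0 \<ge> 0")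
    case True
    then have "\<sigma> * h t = h t" by (simp add: \<sigma>_def)
    then show ?thesis using True r(2)[OF that] t0 by linarith
  next
    case False
    then have "\<sigma> * h t = - h t" by (simp add: \<sigma>_def)
    then show ?thesis using False r(2)[OF that] t0 by linarith
  qed
  obtain K where K: "\<And>x. norm (\<phi> x) \<le> norm x * K" "K \<ge> 0"
    using bounded_linear.nonneg_bounded[OF \<phi>] by blast
  obtain N :: nat where N: "real N * \<delta> > 2 * K" 
    using reals_Archimedean3[OF \<open>\<delta> > 0\<close>] by blast
  \<comment> \<open>The width of the tents: all peaks \<open>t0 + n \<rho>\<close> with \<open>n < N\<close> are within \<open>r\<close> of \<open>t0\<close>.\<close>
  define \<rho> where "\<rho> = r / real (Suc N)"
  have \<rho>: "\<rho> > 0" using r by (simp add: \<rho>_def)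
  have "\<exists>d :: real \<Rightarrow>\<^sub>C real. \<forall>t. d t = tent n ((t - t0) / \<rho>) * (\<sigma> - f t)" for n
  proof -
    have "\<bar>tent n ((t - t0) / \<rho>) * (\<sigma> - f t)\<bar> \<le> 1 * 2" for t
      unfolding abs_mult using tent_bounds[of n "(t - t0) / \<rho>"] fx[of t]
      by (intro mult_mono) (auto simp: \<sigma>_def)
    moreover have "continuous_on UNIV (\<lambda>t. tent n ((t - t0) / \<rho>) * (\<sigma> - f t))"
      unfolding tent_def using \<rho> by (intro continuous_intros) auto
    ultimately show ?thesis
      using bcontfun_of_function[of "\<lambda>t. tent n ((t - t0) / \<rho>) * (\<sigma> - f t)" 2] by (metis mult_1)
  qed
  then obtain d :: "nat \<Rightarrow> real \<Rightarrow>\<^sub>C real" where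
    d: "\<And>n t. d n t = tent n ((t - t0) / \<rho>) * (\<sigma> - f t)" by metis
  have "\<exists>n<N. \<bar>\<phi> (d n)\<bar> < \<delta>"
  proof (rule ccontr)
    assume "\<not> ?thesis"
    then have big: "\<And>n. n < N \<Longrightarrow> \<delta> \<le> \<bar>\<phi> (d n)\<bar>" by force
    define D where "D = (\<Sum>n<N. sgn (\<phi> (d n)) *\<^sub>R d n)"
    have "norm D \<le> 2"
    proof (rule norm_bound)
      fix t
      have ap: "apply_bcontfun (\<Sum>n<k. sgn (\<phi> (d n)) *\<^sub>R d n) t = (\<Sum>n<k. sgn (\<phi> (d n)) * d n t)" for k
        by (induction k) auto
      have "\<bar>sgn (\<phi> (d n)) * d n t\<bar> \<le> tent n ((t - t0) / \<rho>) * 2" for n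
      proof -
        have "\<bar>sgn (\<phi> (d n))\<bar> * (tent n ((t - t0) / \<rho>) * \<bar>\<sigma> - f t\<bar>) \<le> 1 * (tent n ((t - t0) / \<rho>) * 2)"
          using tent_bounds[of n "(t - t0) / \<rho>"] fx[of t]
          by (intro mult_mono) (auto simp: \<sigma>_def sgn_if)
        then show ?thesis using tent_bounds[of n "(t - t0) / \<rho>"] by (simp add: abs_mult d)
      qed
      then have "\<bar>D t\<bar> \<le> (\<Sum>n<N. tent n ((t - t0) / \<rho>) * 2)"
        unfolding D_def ap by (intro order_trans[OF sum_abs] sum_mono)
      also have "\<dots> \<le> 2" using sum_tent_le_1[of "(t - t0) / \<rho>" N] by (simp flip: sum_distrib_right)
      finally show "norm (D t) \<le> 2" by simp
    qed
    have "real N * \<delta> = (\<Sum>n<N. \<delta>)" by simp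
    also have "\<dots> \<le> (\<Sum>n<N. \<bar>\<phi> (d n)\<bar>)" by (intro sum_mono big) simp
    also have "\<dots> = \<phi> D"
      using bounded_linear.linear[OF \<phi>] by (simp add: D_def linear_sum linear_cmul abs_sgn mult.commute)
    also have "\<dots> \<le> norm D * K" using K(1)[of D] by simp
    also have "\<dots> \<le> 2 * K" using \<open>norm D \<le> 2\<close> K(2) by (intro mult_right_mono) auto
    finally show False using N by simp
  qed
  then obtain n where n: "n < N" "\<bar>\<phi> (d n)\<bar> < \<delta>" by blast
  define f' where "f' = f + d n"
  show "\<exists>f'. norm f' \<le> 1 \<and> \<phi> f' > \<phi> f - \<delta> \<and> norm (f' + h) > 1 + norm h - \<delta>"
  proof (intro exI conjI)
    show "norm f' \<le> 1"
    proof (rule norm_bound)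
      fix t
      let ?a = "tent n ((t - t0) / \<rho>)"
      have "f' t = (1 - ?a) * f t + ?a * \<sigma>" by (simp add: f'_def d algebra_simps)
      also have "\<bar>\<dots>\<bar> \<le> (1 - ?a) * 1 + ?a * 1"
        using tent_bounds[of n "(t - t0) / \<rho>"] fx[of t]
        by (intro order_trans[OF abs_triangle_ineq] add_mono; unfold abs_mult; intro mult_mono)
           (auto simp: \<sigma>_def)
      finally show "norm (f' t) \<le> 1" by simp
    qed
    show "\<phi> f' > \<phi> f - \<delta>" using n(2) \<phi> by (simp add: f'_def linear_simps)
    define t where "t = t0 + real n * \<rho>"
    have "real n * \<rho> < real (Suc N) * \<rho>" using n(1) \<rho> by (intro mult_strict_right_mono) auto
    also have "\<dots> = r" by (simp add: \<rho>_def)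
    finally have "\<bar>t - t0\<bar> < r" using \<rho> by (simp add: t_def)
    moreover have "f' t = \<sigma>" using \<rho> by (simp add: f'_def d t_def tent_peak)
    moreover have "\<bar>f' t + h t\<bar> \<le> norm (f' + h)" using norm_bounded[of "f' + h" t] by simp
    ultimately show "norm (f' + h) > 1 + norm h - \<delta>"
      using hit[of t] by (auto simp: \<sigma>_def split: if_splits)
  qed
qed

lemma norm_le_1_if_disjoint_supports:
  fixes w v :: "real \<Rightarrow>\<^sub>C real"
  assumes "norm w \<le> 1" "norm v \<le> 1" "\<And>t. w t = 0 \<or> v t = 0"
  shows "norm (w + v) \<le> 1" "norm (w - v) \<le> 1"
proof -
  have "\<bar>w t + v t\<bar> \<le> 1 \<and> \<bar>w t - v t\<bar> \<le> 1" for t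
    using norm_bounded[of w t] norm_bounded[of v t] assms(1,2) assms(3)[of t] by auto
  then show "norm (w + v) \<le> 1" "norm (w - v) \<le> 1"
    by (auto intro!: norm_bound)
qed

lemma flat_splitting_bcontfun:
  obtains w1 w2 :: "real \<Rightarrow>\<^sub>C real" where "flat_splitting w1 w2"
proof -
  have abs_ramp: "\<bar>ramp t\<bar> \<le> 1" for t using ramp_bounds[of t] by simp
  obtain w1 :: "real \<Rightarrow>\<^sub>C real" where w1: "\<And>t. w1 t = ramp (t - 1)"
    by (rule bcontfun_of_function[of "\<lambda>t. ramp (t - 1)" 1]) (auto intro!: continuous_intros abs_ramp)
  obtain w2 :: "real \<Rightarrow>\<^sub>C real" where w2: "\<And>t. w2 t = ramp (- t)"
    by (rule bcontfun_of_function[of "\<lambda>t. ramp (- t)" 1]) (auto intro!: continuous_intros abs_ramp)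
  \<comment> \<open>A function \<open>y\<close> is split by a partition of unity that passes from one half-line to the other
      on \<open>[0, 1]\<close>; the supports of \<open>w1\<close> and \<open>w2\<close> lie to the right and to the left of this interval.\<close>
  have n1: "norm w1 = 1"
    using norm_bound[of w1 1] norm_bounded[of w1 2] by (simp add: w1 abs_ramp) (simp add: ramp_def)
  have n2: "norm w2 = 1"
    using norm_bound[of w2 1] norm_bounded[of w2 "-1"] by (simp add: w2 abs_ramp) (simp add: ramp_def)
  have "\<exists>v1 v2. y = v1 + v2 \<and> norm (w1 + v1) \<le> 1 \<and> norm (w1 - v1) \<le> 1 \<and>
        norm (w2 + v2) \<le> 1 \<and> norm (w2 - v2) \<le> 1" if y: "norm y \<le> 1" for y
  proof -
    have yt: "\<bar>y t\<bar> \<le> 1" for t using norm_bounded[of y t] y by simp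
    have bd: "\<bar>ramp s * y t\<bar> \<le> 1" for s t
      unfolding abs_mult using mult_mono[OF abs_ramp[of s] yt[of t]] by simp
    obtain v2 :: "real \<Rightarrow>\<^sub>C real" where v2: "\<And>t. v2 t = ramp t * y t"
      by (rule bcontfun_of_function[of "\<lambda>t. ramp t * y t" 1]) (auto intro!: continuous_intros bd)
    obtain v1 :: "real \<Rightarrow>\<^sub>C real" where v1: "\<And>t. v1 t = ramp (1 - t) * y t"
      by (rule bcontfun_of_function[of "\<lambda>t. ramp (1 - t) * y t" 1]) (auto intro!: continuous_intros bd)
    have "y = v1 + v2"
    proof (rule bcontfun_eqI)
      fix t
      have "ramp (1 - t) + ramp t = 1" by (auto simp: ramp_def max_def min_def)
      then show "y t = (v1 + v2) t" by (simp add: v1 v2 flip: distrib_right)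
    qed
    moreover have "norm v1 \<le> 1" "norm v2 \<le> 1"
      using bd by (auto intro!: norm_bound simp: v1 v2)
    moreover have "w1 t = 0 \<or> v1 t = 0" "w2 t = 0 \<or> v2 t = 0" for t
      by (auto simp: w1 w2 v1 v2 ramp_def max_def min_def)
    ultimately show ?thesis
      using n1 n2 norm_le_1_if_disjoint_supports[of w1 v1] norm_le_1_if_disjoint_supports[of w2 v2]
      by (intro exI[of _ v1] exI[of _ v2]) auto
  qed
  then show thesis using that n1 n2 unfolding flat_splitting_def by blast
qed

lemma inj_bcontfun_pairs:
  obtains c :: "(real \<Rightarrow>\<^sub>C real) \<times> (real \<Rightarrow>\<^sub>C real) \<Rightarrow> real set" where "inj c"
proof
  define below :: "(real \<Rightarrow>\<^sub>C real) \<times> (real \<Rightarrow>\<^sub>C real) \<Rightarrow> (bool \<times> rat \<times> rat) set"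
    where "below p = {(b, q, r). of_rat r < (if b then fst p else snd p) (of_rat q)}" for p
  have eq: "f = g" if le: "\<And>q r :: rat. of_rat r < f (of_rat q) \<longleftrightarrow> of_rat r < g (of_rat q)"
    for f g :: "real \<Rightarrow>\<^sub>C real"
  proof (rule bcontfun_eqI)
    have at_rat: "f (of_rat q) = g (of_rat q)" for q
      using le[of _ q] by (metis of_rat_dense less_asym linorder_less_linear)
    have "closed {t. f t = g t}"
      by (intro closed_Collect_eq) auto
    moreover have "\<rat> \<subseteq> {t. f t = g t}" using at_rat by (auto simp: Rats_def)
    ultimately have "closure \<rat> \<subseteq> {t. f t = g t}" by (rule closure_minimal[rotated])
    then show "f t = g t" for t using Rats_closure_real by auto
  qed
  have "inj below"
  proof (rule injI)
    fix p q assume b: "below p = below q"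
    have "(b, x, r) \<in> below p \<longleftrightarrow> (b, x, r) \<in> below q" for b x r by (simp add: b)
    from this[of True] this[of False] show "p = q"
      by (intro prod_eqI eq) (simp_all add: below_def)
  qed
  moreover have "inj ((`) (\<lambda>x :: bool \<times> rat \<times> rat. real (to_nat x)))"
    by (intro injI) (auto simp: inj_image_eq_iff inj_def)
  ultimately show "inj ((`) (\<lambda>x. real (to_nat x)) \<circ> below)"
    by (intro inj_compose)
qed

section \<open>The counterexample\<close>

theorem theorem2p3:
  shows "\<exists>X :: real set normed_space.
    real_banach_space X \<and> daugavet_property X \<and> \<not> weak_operator_daugavet_property X"
proof -
  obtain c :: "(real \<Rightarrow>\<^sub>C real) \<times> (real \<Rightarrow>\<^sub>C real) \<Rightarrow> real set" where "inj c"
    by (rule inj_bcontfun_pairs)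
  interpret l1_sum c by unfold_locales fact
  obtain w1 w2 :: "real \<Rightarrow>\<^sub>C real" where w: "flat_splitting w1 w2"
    by (rule flat_splitting_bcontfun)
  define e :: "real \<Rightarrow>\<^sub>C real" where "e = const_bcontfun 1"
  have e: "norm e = 1" "e 0 = 1"
    using norm_bound[of e 1] norm_bounded[of e 0] by (simp_all add: e_def)
  have ev: "linear (\<lambda>y :: real \<Rightarrow>\<^sub>C real. y 0)" by (rule linearI) simp_all
  have "\<not> weak_operator_daugavet_property X"
    using not_weak_operator_daugavet_property_X[OF w e(1) ev _ e] norm_bounded[of _ 0]
    by (metis real_norm_def)
  moreover have "daugavet_property X"
    by (intro daugavet_property_X slice_daugavet_bcontfun)
  ultimately show ?thesis using real_banach_space_X by blast
qed

end
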